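(* Let $q$ be a prime power, $n$ a positive integer, and $I,J,I_0,J_0$ positive integers with $\max(I+J,\,J+J_0,\,I_0+J_0)<n$, $I<J$ and $I_0<J_0$. Let $\alpha,\beta,\gamma,\overline{\alpha},\overline{\beta},\overline{\gamma}\in\mathbb{F}_{q^n}^*$. If $(I,J)\neq(I_0,J_0)$, then the two sets $U_{\alpha,\beta,\gamma}^{I,J,n}$ and $U_{\overline{\alpha},\overline{\beta},\overline{\gamma}}^{I_0,J_0,n}$ are not $\Gamma L(6,q^n)$-equivalent.
   Context: For positive integers $I<J<n$ and $\alpha,\beta,\gamma\in\mathbb{F}_{q^n}^*$, $$U_{\alpha,\beta,\gamma}^{I,J,n}:=\{(x,y,z,\;x^{q^I}+\alpha y^{q^J},\;x^{q^J}+\beta z^{q^I},\;y^{q^I}+\gamma z^{q^J}) : x,y,z\in\mathbb{F}_{q^n}\}\subseteq\mathbb{F}_{q^n}^6 .$$ Two $\mathbb{F}_q$-subspaces $U,U'$ of $\mathbb{F}_{q^n}^6$ are $\Gamma L(6,q^n)$-equivalent if there exist $M\in GL(6,\mathbb{F}_{q^n})$ and a field automorphism $\sigma\in\mathrm{Aut}(\mathbb{F}_{q^n})$ such that $U'=\{M u^{\sigma} : u\in U\}$, where $\sigma$ acts coordinatewise on column vectors. The overlined letters are simply further elements of $\mathbb{F}_{q^n}^*$. *)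

theory Defs
  imports "HOL-Analysis.Cartesian_Space" "HOL-Number_Theory.Prime_Powers"
begin

text \<open>
  The field with \<open>q ^ n\<close> elements is a type \<open>'a :: {field, finite}\<close> with
  \<open>CARD('a) = q ^ n\<close>; the parameter \<open>n\<close> of the family is thus carried by the type,
  and only the size \<open>q\<close> of the ground field has to be passed explicitly.
\<close>

definition U_set ::
  "nat \<Rightarrow> nat \<Rightarrow> nat \<Rightarrow> 'a \<Rightarrow> 'a \<Rightarrow> 'a \<Rightarrow> ('a :: field ^ 6) set" where
  "U_set q I J \<alpha> \<beta> \<gamma> =
     {vector [x, y, z,
              x ^ (q ^ I) + \<alpha> * y ^ (q ^ J),
              x ^ (q ^ J) + \<beta> * z ^ (q ^ I),
              y ^ (q ^ I) + \<gamma> * z ^ (q ^ J)] | x y z. True}"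

definition field_automorphism :: "('a :: field \<Rightarrow> 'a) \<Rightarrow> bool" where
  "field_automorphism \<sigma> \<longleftrightarrow>
     bij \<sigma> \<and> \<sigma> 1 = 1 \<and>
     (\<forall>x y. \<sigma> (x + y) = \<sigma> x + \<sigma> y) \<and> (\<forall>x y. \<sigma> (x * y) = \<sigma> x * \<sigma> y)"

definition GammaL_equivalent :: "('a :: field ^ 'm) set \<Rightarrow> ('a ^ 'm) set \<Rightarrow> bool" where
  "GammaL_equivalent U U' \<longleftrightarrow>
     (\<exists>(M :: 'a ^ 'm ^ 'm) \<sigma>. invertible M \<and> field_automorphism \<sigma> \<and>
        U' = {M *v (\<chi> i. \<sigma> (u $ i)) | u. u \<in> U})"

end

theory Submission
  imports Defs "HOL-Number_Theory.Residues" "HOL-Computational_Algebra.Polynomial"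
begin

text \<open>
  A field automorphism commutes with \<open>x \<mapsto> x ^ q\<close> and so only changes the parameters of the
  source set; hence the equivalence may be taken linear, given by a matrix \<open>M\<close>.
  As \<open>J + J\<^sub>0 < n\<close>, the equations defining the target set become identities of
  \<open>q\<close>-polynomials of \<open>q\<close>-degree below \<open>n\<close>, whose coefficients can be compared. The top degree
  \<open>J + J\<^sub>0\<close> shows that the first three rows of \<open>M\<close> vanish in columns 4 and 5. Then only the
  degrees \<open>I\<^sub>0\<close> and \<open>J\<^sub>0\<close> are left on the target side, so \<open>I \<notin> {I\<^sub>0, J\<^sub>0}\<close> forces column 4
  to vanish, and \<open>J \<notin> {I\<^sub>0, J\<^sub>0}\<close> forces column 5 to vanish.
\<close>

lemma exhaust_6:
  fixes x :: 6
  shows "x = 1 \<or> x = 2 \<or> x = 3 \<or> x = 4 \<or> x = 5 \<or> x = 6"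
proof (induct x)
  case (of_int z)
  then have "z = 0 \<or> z = 1 \<or> z = 2 \<or> z = 3 \<or> z = 4 \<or> z = 5" by fastforce
  then show ?case by auto
qed

lemma sum_6: "sum f (UNIV :: 6 set) = f 1 + f 2 + f 3 + f 4 + f 5 + f 6"
proof -
  have UNIV_6: "UNIV = {1, 2, 3, 4, 5, 6 :: 6}"
    using exhaust_6 by auto
  show ?thesis
    unfolding UNIV_6 by (simp add: ac_simps)
qed

lemma vector_6:
  fixes a b c d e f :: "'a :: zero"
  shows "(vector [a, b, c, d, e, f] :: 'a ^ 6) $ 1 = a"
    and "(vector [a, b, c, d, e, f] :: 'a ^ 6) $ 2 = b"
    and "(vector [a, b, c, d, e, f] :: 'a ^ 6) $ 3 = c"
    and "(vector [a, b, c, d, e, f] :: 'a ^ 6) $ 4 = d"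
    and "(vector [a, b, c, d, e, f] :: 'a ^ 6) $ 5 = e"
    and "(vector [a, b, c, d, e, f] :: 'a ^ 6) $ 6 = f"
  unfolding vector_def by simp_all

lemma invertible_column_nonzero:
  fixes M :: "'a :: field ^ 'n ^ 'n"
  assumes "invertible M"
  shows "\<exists>i. M $ i $ k \<noteq> 0"
proof (rule ccontr)
  assume "\<not> ?thesis"
  then have "M *v axis k 1 = 0"
    by (simp add: matrix_vector_mult_def axis_def vec_eq_iff if_distrib cong: if_cong)
  then have "axis k (1 :: 'a) = 0"
    using assms by (metis invertible_left_inverse matrix_left_invertible_ker)
  then show False
    by (simp add: axis_eq_0_iff)
qed

text \<open>The characteristic is prime and divides the field size, a power of \<open>p\<close>, so
  it equals \<open>p\<close>. Thus \<open>q ^ k\<close> is a power of the characteristic, and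
  iterated Frobenius is additive.\<close>

lemma frobenius_power_add:
  fixes x y :: "'a :: {field, finite}"
  assumes "primepow q" "CARD('a) = q ^ n"
  shows "(x + y) ^ (q ^ k) = x ^ (q ^ k) + y ^ (q ^ k)"
proof -
  obtain p m where pm: "prime p" "q = p ^ m"
    using assms(1) by (auto simp: primepow_def)
  have "prime CHAR('a)"
    by (rule prime_CHAR_semidom) (simp add: finite_imp_CHAR_pos)
  moreover have "CHAR('a) dvd (p ^ m) ^ n"
    using CHAR_dvd_CARD[where 'a = 'a] assms(2) pm(2) by simp
  ultimately have "CHAR('a) = p"
    using pm(1) by (meson prime_dvd_power primes_dvd_imp_eq)
  then show ?thesis
    using \<open>prime CHAR('a)\<close> pm(2)
    by (intro freshmans_dream'[where n = "m * k"]) (auto simp: power_mult)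
qed

text \<open>The list evaluates a polynomial of degree below \<open>q ^ n\<close> that vanishes on
  all \<open>q ^ n\<close> field elements, so it is the zero polynomial. Exponents may repeat in the
  list, hence the conclusion adds all coefficients that share the exponent \<open>k\<close>.\<close>

lemma q_polynomial_coeff_eq_0:
  fixes cs :: "('a :: {field, finite} \<times> nat) list"
  assumes "q > 1" and card: "CARD('a) = q ^ n"
    and deg: "\<forall>(a, e) \<in> set cs. e < n"
    and zero: "\<And>t. (\<Sum>(a, e)\<leftarrow>cs. a * t ^ (q ^ e)) = 0"
  shows "(\<Sum>(a, e)\<leftarrow>cs. if e = k then a else 0) = 0"
proof -
  define p where "p = (\<Sum>(a, e)\<leftarrow>cs. Polynomial.monom a (q ^ e))"
  have "poly p t = (\<Sum>(a, e)\<leftarrow>cs. a * t ^ (q ^ e))" for t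
    unfolding p_def by (induction cs) (auto simp: poly_monom)
  then have roots: "{t. poly p t = 0} = UNIV"
    using zero by simp
  have coeff: "poly.coeff p m = (\<Sum>(a, e)\<leftarrow>cs. if q ^ e = m then a else 0)" for m
    unfolding p_def by (induction cs) auto
  have "p = 0"
  proof (rule ccontr)
    assume "p \<noteq> 0"
    have "poly.coeff p m = 0" if "m \<ge> q ^ n" for m
      using deg \<open>q > 1\<close> that unfolding coeff
      by (induction cs) (auto simp: leD power_strict_increasing)
    then have "Polynomial.degree p < q ^ n"
      using \<open>p \<noteq> 0\<close> by (metis leading_coeff_0_iff not_le)
    moreover have "card {t. poly p t = 0} \<le> Polynomial.degree p"
      using \<open>p \<noteq> 0\<close> by (rule card_poly_roots_bound)
    ultimately show False
      using card roots by simp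
  qed
  then have "poly.coeff p (q ^ k) = 0"
    by simp
  then show ?thesis
    using \<open>q > 1\<close> by (simp add: coeff power_inject_exp)
qed

text \<open>Both scalars \<epsilon> and \<delta> are kept so that one statement serves all three
  defining equations of the target set; each of them has the scalar 1 in one of the two
  places.\<close>

lemma q_polynomial_relation:
  fixes a\<^sub>1 b\<^sub>1 c\<^sub>1 a\<^sub>2 b\<^sub>2 c\<^sub>2 a b c \<delta> \<epsilon> :: "'a :: {field, finite}"
  assumes q: "primepow q" and card: "CARD('a) = q ^ n"
    and less: "I < J" "I\<^sub>0 < J\<^sub>0" "J + J\<^sub>0 < n" and pos: "I > 0" "I\<^sub>0 > 0" and "\<delta> \<noteq> 0"
    and rel: "\<And>t. a * t + b * t ^ (q ^ I) + c * t ^ (q ^ J)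
      = \<epsilon> * (a\<^sub>1 * t + b\<^sub>1 * t ^ (q ^ I) + c\<^sub>1 * t ^ (q ^ J)) ^ (q ^ I\<^sub>0)
      + \<delta> * (a\<^sub>2 * t + b\<^sub>2 * t ^ (q ^ I) + c\<^sub>2 * t ^ (q ^ J)) ^ (q ^ J\<^sub>0)"
  shows "c\<^sub>2 = 0"
    and "\<lbrakk>b\<^sub>1 = 0; c\<^sub>1 = 0; b\<^sub>2 = 0; I \<noteq> I\<^sub>0; I \<noteq> J\<^sub>0\<rbrakk> \<Longrightarrow> b = 0"
    and "\<lbrakk>b\<^sub>1 = 0; c\<^sub>1 = 0; b\<^sub>2 = 0; J \<noteq> I\<^sub>0; J \<noteq> J\<^sub>0\<rbrakk> \<Longrightarrow> c = 0"
proof -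
  \<comment> \<open>Left side minus right side of \<open>rel\<close>: raising to the power
    \<open>q ^ I\<^sub>0\<close> or \<open>q ^ J\<^sub>0\<close> shifts every exponent by
    \<open>I\<^sub>0\<close> or \<open>J\<^sub>0\<close>.\<close>
  define cs where "cs = [(a, 0), (b, I), (c, J),
    (- \<epsilon> * a\<^sub>1 ^ (q ^ I\<^sub>0), I\<^sub>0), (- \<epsilon> * b\<^sub>1 ^ (q ^ I\<^sub>0), I + I\<^sub>0), (- \<epsilon> * c\<^sub>1 ^ (q ^ I\<^sub>0), J + I\<^sub>0),
    (- \<delta> * a\<^sub>2 ^ (q ^ J\<^sub>0), J\<^sub>0), (- \<delta> * b\<^sub>2 ^ (q ^ J\<^sub>0), I + J\<^sub>0), (- \<delta> * c\<^sub>2 ^ (q ^ J\<^sub>0), J + J\<^sub>0)]"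
  have q1: "q > 1"
    using primepow_gt_Suc_0[OF q] by simp
  have zero: "(\<Sum>(a, e)\<leftarrow>cs. a * t ^ (q ^ e)) = 0" for t
    using rel[of t]
    by (simp add: cs_def frobenius_power_add[OF q card] power_mult_distrib power_add
        algebra_simps flip: power_mult)
  have coeff: "(\<Sum>(a, e)\<leftarrow>cs. if e = k then a else 0) = 0" for k
    by (rule q_polynomial_coeff_eq_0[OF q1 card _ zero]) (use less in \<open>auto simp: cs_def\<close>)
  \<comment> \<open>Only the last entry of \<open>cs\<close> has exponent
    \<open>J + J\<^sub>0\<close>; all the others are smaller.\<close>
  show "c\<^sub>2 = 0"
    using coeff[of "J + J\<^sub>0"] less pos \<open>\<delta> \<noteq> 0\<close> by (simp add: cs_def)
  \<comment> \<open>The vanishing coefficients remove the shifted terms, which could otherwise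
    collide with the left side, for example if \<open>I + I\<^sub>0 = J\<close>.\<close>
  then show "\<lbrakk>b\<^sub>1 = 0; c\<^sub>1 = 0; b\<^sub>2 = 0; I \<noteq> I\<^sub>0; I \<noteq> J\<^sub>0\<rbrakk> \<Longrightarrow> b = 0"
    and "\<lbrakk>b\<^sub>1 = 0; c\<^sub>1 = 0; b\<^sub>2 = 0; J \<noteq> I\<^sub>0; J \<noteq> J\<^sub>0\<rbrakk> \<Longrightarrow> c = 0"
    using coeff[of I] coeff[of J] less pos q1 by (simp_all add: cs_def power_0_left)
qed

text \<open>In coordinate 5 the summands are swapped, so that the smaller exponent comes first in
  every row, as \<open>q_polynomial_relation\<close> expects.\<close>

lemma U_set_coordinates:
  assumes "w \<in> U_set q I J \<alpha> \<beta> \<gamma>"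
  shows "w $ 4 = (w $ 1) ^ (q ^ I) + \<alpha> * (w $ 2) ^ (q ^ J)"
    and "w $ 5 = \<beta> * (w $ 3) ^ (q ^ I) + (w $ 1) ^ (q ^ J)"
    and "w $ 6 = (w $ 2) ^ (q ^ I) + \<gamma> * (w $ 3) ^ (q ^ J)"
  using assms by (auto simp: U_set_def vector_6)

lemma field_automorphism_power:
  assumes "field_automorphism \<sigma>"
  shows "\<sigma> (x ^ m) = \<sigma> x ^ m"
  using assms by (induction m) (auto simp: field_automorphism_def)

lemma field_automorphism_0:
  assumes "field_automorphism \<sigma>"
  shows "\<sigma> 0 = 0"
  using assms unfolding field_automorphism_def by (metis add_cancel_right_right)

text \<open>Preimages of \<open>x\<close>, \<open>y\<close>, \<open>z\<close> exist as \<sigma> is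
  surjective, and \<sigma> commutes with powers. This inclusion lets \<open>M\<close> alone map the
  set with transformed parameters into the target.\<close>

lemma U_set_field_automorphism:
  assumes "field_automorphism \<sigma>" "w \<in> U_set q I J (\<sigma> \<alpha>) (\<sigma> \<beta>) (\<sigma> \<gamma>)"
  shows "\<exists>u \<in> U_set q I J \<alpha> \<beta> \<gamma>. (\<chi> i. \<sigma> (u $ i)) = w"
proof -
  from assms(2) obtain x y z where w: "w = vector [x, y, z,
      x ^ (q ^ I) + \<sigma> \<alpha> * y ^ (q ^ J),
      x ^ (q ^ J) + \<sigma> \<beta> * z ^ (q ^ I),
      y ^ (q ^ I) + \<sigma> \<gamma> * z ^ (q ^ J)]"
    by (auto simp: U_set_def)
  have "surj \<sigma>"
    using assms(1) by (simp add: field_automorphism_def bij_def)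
  then obtain x' y' z' where xyz: "x = \<sigma> x'" "y = \<sigma> y'" "z = \<sigma> z'"
    by (meson surjD)
  define u :: "'a ^ 6" where "u = vector [x', y', z',
      x' ^ (q ^ I) + \<alpha> * y' ^ (q ^ J),
      x' ^ (q ^ J) + \<beta> * z' ^ (q ^ I),
      y' ^ (q ^ I) + \<gamma> * z' ^ (q ^ J)]"
  have hom: "\<sigma> (r + s) = \<sigma> r + \<sigma> s" "\<sigma> (r * s) = \<sigma> r * \<sigma> s" for r s
    using assms(1) by (simp_all add: field_automorphism_def)
  have "\<sigma> (u $ i) = w $ i" for i
    using exhaust_6[of i]
    by (auto simp: u_def w xyz vector_6 hom field_automorphism_power[OF assms(1)])
  moreover have "u \<in> U_set q I J \<alpha> \<beta> \<gamma>"
    unfolding U_set_def u_def by blast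
  ultimately show ?thesis
    by (intro bexI[of _ u]) (simp_all add: vec_eq_iff)
qed

theorem theorem3p1:
  fixes q n I J I\<^sub>0 J\<^sub>0 :: nat
    and \<alpha> \<beta> \<gamma> \<alpha>' \<beta>' \<gamma>' :: "'a :: {field, finite}"
  assumes "primepow q" and "n > 0" and "CARD('a) = q ^ n"
    and "I > 0" and "J > 0" and "I\<^sub>0 > 0" and "J\<^sub>0 > 0"
    and "Max {I + J, J + J\<^sub>0, I\<^sub>0 + J\<^sub>0} < n"
    and "I < J" and "I\<^sub>0 < J\<^sub>0"
    and "\<alpha> \<noteq> 0" and "\<beta> \<noteq> 0" and "\<gamma> \<noteq> 0"
    and "\<alpha>' \<noteq> 0" and "\<beta>' \<noteq> 0" and "\<gamma>' \<noteq> 0"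
    and "(I, J) \<noteq> (I\<^sub>0, J\<^sub>0)"
  shows "\<not> GammaL_equivalent (U_set q I J \<alpha> \<beta> \<gamma>) (U_set q I\<^sub>0 J\<^sub>0 \<alpha>' \<beta>' \<gamma>')"
proof
  assume "GammaL_equivalent (U_set q I J \<alpha> \<beta> \<gamma>) (U_set q I\<^sub>0 J\<^sub>0 \<alpha>' \<beta>' \<gamma>')"
  then obtain M :: "'a ^ 6 ^ 6" and \<sigma> where inv: "invertible M" and \<sigma>: "field_automorphism \<sigma>"
    and U': "U_set q I\<^sub>0 J\<^sub>0 \<alpha>' \<beta>' \<gamma>' = {M *v (\<chi> i. \<sigma> (u $ i)) | u. u \<in> U_set q I J \<alpha> \<beta> \<gamma>}"
    unfolding GammaL_equivalent_def by blast
  have image: "M *v w \<in> U_set q I\<^sub>0 J\<^sub>0 \<alpha>' \<beta>' \<gamma>'"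
    if "w \<in> U_set q I J (\<sigma> \<alpha>) (\<sigma> \<beta>) (\<sigma> \<gamma>)" for w
    using U_set_field_automorphism[OF \<sigma> that] unfolding U' by blast
  have "q > 1"
    using primepow_gt_Suc_0[OF assms(1)] by simp
  have "bij \<sigma>"
    using \<sigma> by (simp add: field_automorphism_def)
  then have "\<sigma> \<alpha> \<noteq> 0"
    using field_automorphism_0[OF \<sigma>] \<open>\<alpha> \<noteq> 0\<close> by (metis bij_pointE)
  have bound: "J + J\<^sub>0 < n"
    using assms(8) by simp
  note relation = q_polynomial_relation[OF assms(1,3,9,10) bound assms(4,6)]
  \<comment> \<open>Row \<open>i\<close> of \<open>M\<close> on the points with
    \<open>x = t\<close>, \<open>y = z = 0\<close> (\<open>?c\<close>) and with
    \<open>y = t\<close>, \<open>x = z = 0\<close> (\<open>?d\<close>). The coefficient at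
    \<open>q ^ J\<close> reads off column 5 in \<open>?c\<close>, and column 4 times
    \<open>\<sigma> \<alpha>\<close> in \<open>?d\<close>.\<close>
  let ?c = "\<lambda>i t. M $ i $ 1 * t + M $ i $ 4 * t ^ (q ^ I) + M $ i $ 5 * t ^ (q ^ J)"
  let ?d = "\<lambda>i t. M $ i $ 2 * t + M $ i $ 6 * t ^ (q ^ I) + M $ i $ 4 * \<sigma> \<alpha> * t ^ (q ^ J)"
  have image_x: "M *v vector [t, 0, 0, t ^ (q ^ I), t ^ (q ^ J), 0]
      \<in> U_set q I\<^sub>0 J\<^sub>0 \<alpha>' \<beta>' \<gamma>'" for t
    by (rule image) (unfold U_set_def, rule CollectI,
      rule exI[of _ t], rule exI[of _ 0], rule exI[of _ 0], use \<open>q > 1\<close> in \<open>simp add: power_0_left\<close>)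
  have image_y: "M *v vector [0, t, 0, \<sigma> \<alpha> * t ^ (q ^ J), 0, t ^ (q ^ I)]
      \<in> U_set q I\<^sub>0 J\<^sub>0 \<alpha>' \<beta>' \<gamma>'" for t
    by (rule image) (unfold U_set_def, rule CollectI,
      rule exI[of _ 0], rule exI[of _ t], rule exI[of _ 0], use \<open>q > 1\<close> in \<open>simp add: power_0_left\<close>)
  have c: "(M *v vector [t, 0, 0, t ^ (q ^ I), t ^ (q ^ J), 0]) $ i = ?c i t" for i t
    by (simp add: matrix_vector_mult_def sum_6 vector_6)
  have d: "(M *v vector [0, t, 0, \<sigma> \<alpha> * t ^ (q ^ J), 0, t ^ (q ^ I)]) $ i = ?d i t" for i t
    by (simp add: matrix_vector_mult_def sum_6 vector_6)
  have x4: "?c 4 t = 1 * ?c 1 t ^ (q ^ I\<^sub>0) + \<alpha>' * ?c 2 t ^ (q ^ J\<^sub>0)" for t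
    using U_set_coordinates(1)[OF image_x, of t] unfolding c by simp
  have x5: "?c 5 t = \<beta>' * ?c 3 t ^ (q ^ I\<^sub>0) + 1 * ?c 1 t ^ (q ^ J\<^sub>0)" for t
    using U_set_coordinates(2)[OF image_x, of t] unfolding c by simp
  have x6: "?c 6 t = 1 * ?c 2 t ^ (q ^ I\<^sub>0) + \<gamma>' * ?c 3 t ^ (q ^ J\<^sub>0)" for t
    using U_set_coordinates(3)[OF image_x, of t] unfolding c by simp
  have y4: "?d 4 t = 1 * ?d 1 t ^ (q ^ I\<^sub>0) + \<alpha>' * ?d 2 t ^ (q ^ J\<^sub>0)" for t
    using U_set_coordinates(1)[OF image_y, of t] unfolding d by simp
  have y5: "?d 5 t = \<beta>' * ?d 3 t ^ (q ^ I\<^sub>0) + 1 * ?d 1 t ^ (q ^ J\<^sub>0)" for t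
    using U_set_coordinates(2)[OF image_y, of t] unfolding d by simp
  have y6: "?d 6 t = 1 * ?d 2 t ^ (q ^ I\<^sub>0) + \<gamma>' * ?d 3 t ^ (q ^ J\<^sub>0)" for t
    using U_set_coordinates(3)[OF image_y, of t] unfolding d by simp
  note rel4 = relation[OF \<open>\<alpha>' \<noteq> 0\<close> x4]
  note rel5 = relation[OF one_neq_zero x5]
  note rel6 = relation[OF \<open>\<gamma>' \<noteq> 0\<close> x6]
  \<comment> \<open>The power \<open>q ^ J\<^sub>0\<close> is applied to row 2, 1, 3 in equation 4,
    5, 6 respectively, which explains the order of the facts.\<close>
  have top5: "M $ 1 $ 5 = 0" "M $ 2 $ 5 = 0" "M $ 3 $ 5 = 0"
    by (fact rel5(1) rel4(1) rel6(1))+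
  have "M $ 1 $ 4 * \<sigma> \<alpha> = 0" "M $ 2 $ 4 * \<sigma> \<alpha> = 0" "M $ 3 $ 4 * \<sigma> \<alpha> = 0"
    by (fact relation(1)[OF one_neq_zero y5] relation(1)[OF \<open>\<alpha>' \<noteq> 0\<close> y4]
        relation(1)[OF \<open>\<gamma>' \<noteq> 0\<close> y6])+
  then have top4: "M $ 1 $ 4 = 0" "M $ 2 $ 4 = 0" "M $ 3 $ 4 = 0"
    using \<open>\<sigma> \<alpha> \<noteq> 0\<close> by simp_all
  have I: "I = I\<^sub>0 \<or> I = J\<^sub>0"
  proof (rule ccontr)
    assume "\<not> ?thesis"
    \<comment> \<open>Comparison at degree \<open>I\<close> in the three \<open>?c\<close>
      equations; with \<open>top4\<close> the whole column 4 vanishes, against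
      invertibility.\<close>
    then have "M $ 4 $ 4 = 0" "M $ 5 $ 4 = 0" "M $ 6 $ 4 = 0"
      using rel4(2) rel5(2) rel6(2) top4 top5 by blast+
    then have "M $ i $ 4 = 0" for i
      using exhaust_6[of i] top4 by auto
    then show False
      using invertible_column_nonzero[OF inv, of 4] by blast
  qed
  have J: "J = I\<^sub>0 \<or> J = J\<^sub>0"
  proof (rule ccontr)
    assume "\<not> ?thesis"
    then have "M $ 4 $ 5 = 0" "M $ 5 $ 5 = 0" "M $ 6 $ 5 = 0"
      using rel4(3) rel5(3) rel6(3) top4 top5 by blast+
    then have "M $ i $ 5 = 0" for i
      using exhaust_6[of i] top5 by auto
    then show False
      using invertible_column_nonzero[OF inv, of 5] by blast
  qed
  \<comment> \<open>Two increasing pairs with entries in the same two-element set coincide.\<close>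
  from I J show False
    using \<open>I < J\<close> \<open>I\<^sub>0 < J\<^sub>0\<close> \<open>(I, J) \<noteq> (I\<^sub>0, J\<^sub>0)\<close> by auto
qed

end
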